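(* Let $n \ge 1$. For every $n$-variable Boolean function $f:\{-1,1\}^n\to\{-1,1\}$ there exists a polynomial threshold function representation of $f$ of length at most $0.75\times 2^n$ all of whose coefficients are integers with absolute value at most $2^{\,n2^{n-3}-2^{n-1}+4n}$. Equivalently, writing $h=2^n$ and letting $w$ be the coefficient vector of this representation, $\max_i |w_i| \le 2^{\,0.125\,h\log_2 h-0.5\,h+4\log_2 h}$.
   Context: An $n$-variable Boolean function is a map $f:\{-1,1\}^n\to\{-1,1\}$. A multilinear real polynomial $p(x_1,\dots,x_n)=\sum_{S\subseteq\{1,\dots,n\}} w_S\prod_{k\in S}x_k$ is a polynomial threshold function (PTF) representation of $f$ (it sign-represents $f$) if $f(x)=\operatorname{sgn}(p(x))$ for all $x\in\{-1,1\}^n$; in particular $p(x)\ne 0$ for all such $x$. The length (density) of the representation is the number of monomials with non-zero coefficient $w_S$. *)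

theory Defs
  imports Complex_Main "HOL-Library.FuncSet"
begin

text \<open>
  Points are functions on the index set \<open>{1..n}\<close>, taken to be \<open>undefined\<close> elsewhere, so that
  distinct elements of \<open>cube n\<close> are distinct points of the hypercube.
\<close>

definition cube :: "nat \<Rightarrow> (nat \<Rightarrow> real) set" where
  "cube n = {1..n} \<rightarrow>\<^sub>E {-1, 1}"

definition boolean_function :: "nat \<Rightarrow> ((nat \<Rightarrow> real) \<Rightarrow> real) \<Rightarrow> bool" where
  "boolean_function n f \<longleftrightarrow> f \<in> cube n \<rightarrow> {-1, 1}"

text \<open>
  A multilinear polynomial in \<open>n\<close> variables is given by its coefficients \<open>w S\<close> for
  \<open>S \<subseteq> {1..n}\<close>; the values of \<open>w\<close> at other sets play no role.
\<close>

definition multilinear :: "nat \<Rightarrow> (nat set \<Rightarrow> real) \<Rightarrow> (nat \<Rightarrow> real) \<Rightarrow> real" where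
  "multilinear n w x = (\<Sum>S\<in>Pow {1..n}. w S * (\<Prod>k\<in>S. x k))"

text \<open>
  Since \<open>sgn 0 = 0\<close>, a representation of a function with values in \<open>{-1, 1}\<close> does not vanish
  on the cube.
\<close>

definition ptf_representation :: "nat \<Rightarrow> (nat set \<Rightarrow> real) \<Rightarrow> ((nat \<Rightarrow> real) \<Rightarrow> real) \<Rightarrow> bool" where
  "ptf_representation n w f \<longleftrightarrow> (\<forall>x\<in>cube n. f x = sgn (multilinear n w x))"

definition ptf_length :: "nat \<Rightarrow> (nat set \<Rightarrow> real) \<Rightarrow> nat" where
  "ptf_length n w = card {S \<in> Pow {1..n}. w S \<noteq> 0}"

end

theory Submission
  imports Defs "Jordan_Normal_Form.Determinant"
begin

text \<open>
  Split \<open>x\<close> into \<open>y\<close> (the first \<open>n - 1\<close> coordinates) and \<open>t = x n\<close>, and look for the polynomial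
  as \<open>P y + t * R y\<close>. Where \<open>f\<close> depends on \<open>t\<close>, any \<open>P\<close> is acceptable provided \<open>R\<close> dominates it with
  the right sign; where \<open>f\<close> does not depend on \<open>t\<close>, the roles of \<open>P\<close> and \<open>R\<close> are exchanged. One of
  the two kinds of \<open>y\<close> occurs at least \<open>k = 2 ^ (n - 2)\<close> times. Fix \<open>k\<close> such points. The corresponding
  rows of the matrix of characters contain a nonsingular \<open>k \<times> k\<close> minor, so the values of the
  unconstrained component at these points can be chosen to annihilate its \<open>k\<close> coefficients belonging
  to the columns of the minor, whatever signs are prescribed at the other points.

  By Cramer's rule the solution is integral after scaling by the determinant. A sign matrix of size
  \<open>k\<close> has determinant divisible by \<open>2 ^ (k - 1)\<close> and, by Hadamard's inequality, of modulus at most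
  \<open>k powr (k / 2)\<close>; dividing out the power of two gives the bound on the coefficients.
\<close>

section \<open>Elimination, Schur complements and Hadamard's inequality\<close>

text \<open>The row operations amount to left multiplication by the unit lower triangular matrix
  \<open>E\<close>, whose determinant is 1.\<close>

lemma det_eliminate_first_row:
  fixes A :: "'a :: idom mat"
  assumes A: "A \<in> carrier_mat (Suc k) (Suc k)"
  shows "det (mat (Suc k) (Suc k) (\<lambda>(i, j). if i = 0 then A $$ (0, j) else A $$ (i, j) - c i * A $$ (0, j))) = det A"
proof -
  define E where "E = mat (Suc k) (Suc k) (\<lambda>(i, j). if i = j then 1 else if j = 0 then - c i else (0 :: 'a))"
  have E: "E \<in> carrier_mat (Suc k) (Suc k)"
    by (simp add: E_def)
  have "diag_mat E = map (\<lambda>i. 1) [0..<Suc k]"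
    unfolding diag_mat_def by (rule map_cong) (auto simp: E_def)
  then have "prod_list (diag_mat E) = 1"
    by (simp add: map_replicate_const)
  moreover have "det E = prod_list (diag_mat E)"
    by (rule det_lower_triangular[OF _ E]) (auto simp: E_def)
  ultimately have "det E = 1"
    by simp
  moreover have "E * A = mat (Suc k) (Suc k) (\<lambda>(i, j). if i = 0 then A $$ (0, j) else A $$ (i, j) - c i * A $$ (0, j))"
  proof (rule eq_matI, goal_cases)
    case (1 i j)
    then have ij: "i < Suc k" "j < Suc k"
      by auto
    have "(E * A) $$ (i, j) = (\<Sum>l\<in>{0..<Suc k}. E $$ (i, l) * A $$ (l, j))"
      using ij A E by (simp add: scalar_prod_def del: sum.op_ivl_Suc)
    also have "\<dots> = (\<Sum>l\<in>{0, i}. E $$ (i, l) * A $$ (l, j))"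
      by (rule sum.mono_neutral_right) (use ij in \<open>auto simp: E_def\<close>)
    also have "\<dots> = (if i = 0 then A $$ (0, j) else A $$ (i, j) - c i * A $$ (0, j))"
      using ij by (auto simp: E_def)
    finally show ?case
      using ij by simp
  qed (use A E in auto)
  ultimately show ?thesis
    using det_mult[OF E A] by simp
qed

text \<open>After elimination the first column is zero below its top entry, so expanding along it
  leaves one term. The multipliers \<open>c\<close> are specified by an equation rather than as
  quotients, which covers a zero corner entry and makes sense over any integral domain.\<close>

lemma det_schur_complement:
  fixes A :: "'a :: idom mat"
  assumes A: "A \<in> carrier_mat (Suc k) (Suc k)"
    and c: "\<And>i. 0 < i \<Longrightarrow> i \<le> k \<Longrightarrow> A $$ (i, 0) = c i * A $$ (0, 0)"
  shows "det A = A $$ (0, 0) * det (mat k k (\<lambda>(i, j). A $$ (Suc i, Suc j) - c (Suc i) * A $$ (0, Suc j)))"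
proof -
  define B where "B = mat (Suc k) (Suc k) (\<lambda>(i, j). if i = 0 then A $$ (0, j) else A $$ (i, j) - c i * A $$ (0, j))"
  have B: "B \<in> carrier_mat (Suc k) (Suc k)"
    by (simp add: B_def)
  have "det A = det B"
    unfolding B_def by (rule det_eliminate_first_row[OF A, symmetric])
  also have "\<dots> = (\<Sum>i<Suc k. B $$ (i, 0) * cofactor B i 0)"
    by (rule laplace_expansion_column[OF B]) simp
  also have "\<dots> = (\<Sum>i\<in>{0}. B $$ (i, 0) * cofactor B i 0)"
    by (rule sum.mono_neutral_right) (auto simp: B_def c)
  also have "\<dots> = A $$ (0, 0) * det (mat_delete B 0 0)"
    by (simp add: B_def cofactor_def)
  also have "mat_delete B 0 0 = mat k k (\<lambda>(i, j). A $$ (Suc i, Suc j) - c (Suc i) * A $$ (0, Suc j))"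
    by (rule eq_matI) (auto simp: B_def mat_delete_def)
  finally show ?thesis .
qed

text \<open>
  The Schur complement of a Gram matrix is the Gram matrix of the vectors projected to the orthogonal
  complement of the first one, and projecting does not increase norms.
\<close>

lemma det_gram_le:
  fixes r :: "nat \<Rightarrow> 'x \<Rightarrow> real"
  assumes X: "finite X"
  defines "ip \<equiv> \<lambda>u v :: 'x \<Rightarrow> real. \<Sum>x\<in>X. u x * v x"
  shows "det (mat k k (\<lambda>(i, j). ip (r i) (r j))) \<le> (\<Prod>i<k. ip (r i) (r i))"
proof (induction k arbitrary: r)
  case 0
  then show ?case
    by simp
next
  case (Suc k)
  define c where "c = (\<lambda>i. ip (r i) (r 0) / ip (r 0) (r 0))"
  define s where "s = (\<lambda>i x. r (Suc i) x - c (Suc i) * r 0 x)"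
  define G where "G = mat (Suc k) (Suc k) (\<lambda>(i, j). ip (r i) (r j))"
  have G: "G \<in> carrier_mat (Suc k) (Suc k)"
    by (simp add: G_def)
  have ip_nonneg: "ip u u \<ge> 0" for u
    by (auto simp: ip_def intro: sum_nonneg)
  have c: "ip (r i) (r 0) = c i * ip (r 0) (r 0)" for i
  \<comment> \<open>If \<open>r 0\<close> has norm zero, it vanishes on \<open>X\<close>, so both
    sides are 0 whatever value the quotient \<open>c i\<close> takes.\<close>
  proof (cases "ip (r 0) (r 0) = 0")
    case True
    then have "\<forall>x\<in>X. r 0 x * r 0 x = 0"
      using X by (simp add: ip_def sum_nonneg_eq_0_iff)
    then have "ip (r i) (r 0) = 0"
      by (simp add: ip_def)
    then show ?thesis
      using True by simp
  qed (simp add: c_def)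
  have s_ip: "ip (s i) v = ip (r (Suc i)) v - c (Suc i) * ip (r 0) v" for i v
    by (simp add: ip_def s_def algebra_simps sum_subtractf sum_distrib_left)
  have ip_sym: "ip u v = ip v u" for u v
    by (simp add: ip_def mult.commute)
  have orth: "ip (s i) (r 0) = 0" for i
    unfolding s_ip using c[of "Suc i"] by simp
  have s_s: "ip (s i) (s j) = ip (r (Suc i)) (r (Suc j)) - c (Suc i) * ip (r 0) (r (Suc j))" for i j
  proof -
    have "ip (s i) (s j) = ip (s i) (r (Suc j)) - c (Suc j) * ip (s i) (r 0)"
      using s_ip[of j "s i"] by (simp only: ip_sym)
    then show ?thesis
      unfolding orth using s_ip[of i "r (Suc j)"] by linarith
  qed
  have "det G = G $$ (0, 0) * det (mat k k (\<lambda>(i, j). G $$ (Suc i, Suc j) - c (Suc i) * G $$ (0, Suc j)))"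
  proof (rule det_schur_complement[OF G])
    fix i assume "0 < i" "i \<le> k"
    then show "G $$ (i, 0) = c i * G $$ (0, 0)"
      using c[of i] by (simp add: G_def)
  qed
  also have "mat k k (\<lambda>(i, j). G $$ (Suc i, Suc j) - c (Suc i) * G $$ (0, Suc j)) = mat k k (\<lambda>(i, j). ip (s i) (s j))"
    by (rule eq_matI) (auto simp: G_def s_s)
  also have "G $$ (0, 0) * det (mat k k (\<lambda>(i, j). ip (s i) (s j))) \<le> ip (r 0) (r 0) * (\<Prod>i<k. ip (s i) (s i))"
    using Suc.IH[of s] ip_nonneg by (simp add: G_def mult_left_mono)
  also have "\<dots> \<le> ip (r 0) (r 0) * (\<Prod>i<k. ip (r (Suc i)) (r (Suc i)))"
  proof (intro mult_left_mono prod_mono conjI ip_nonneg)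
    fix i
    have "c (Suc i) * ip (r 0) (r (Suc i)) = (c (Suc i))\<^sup>2 * ip (r 0) (r 0)"
      using c[of "Suc i"] ip_sym[of "r 0" "r (Suc i)"] by (simp add: power2_eq_square)
    also have "\<dots> \<ge> 0"
      by (simp add: ip_nonneg)
    finally show "ip (s i) (s i) \<le> ip (r (Suc i)) (r (Suc i))"
      by (simp add: s_s)
  qed
  also have "\<dots> = (\<Prod>i<Suc k. ip (r i) (r i))"
    by (rule prod.lessThan_Suc_shift[symmetric])
  finally show ?case
    by (simp add: G_def)
qed

text \<open>\<open>M * transpose_mat M\<close> is the Gram matrix of the rows of \<open>M\<close>,
  and each row has squared norm \<open>k\<close>; hence \<open>(det M)\<^sup>2\<close> is at most
  \<open>k ^ k\<close>.\<close>

lemma hadamard_sign_matrix: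
  fixes M :: "real mat"
  assumes k: "0 < k" and M: "M \<in> carrier_mat k k"
    and sgn: "\<And>i j. i < k \<Longrightarrow> j < k \<Longrightarrow> M $$ (i, j) \<in> {-1, 1}"
  shows "\<bar>det M\<bar> \<le> real k powr (real k / 2)"
proof -
  have "(det M)\<^sup>2 = det (M * transpose_mat M)"
    using det_mult[OF M, of "transpose_mat M"] det_transpose[OF M] M by (simp add: power2_eq_square)
  also have "M * transpose_mat M = mat k k (\<lambda>(i, j). \<Sum>l\<in>{0..<k}. M $$ (i, l) * M $$ (j, l))"
    by (rule eq_matI) (use M in \<open>auto simp: scalar_prod_def\<close>)
  also have "det \<dots> \<le> (\<Prod>i<k. \<Sum>l\<in>{0..<k}. M $$ (i, l) * M $$ (i, l))"
    using det_gram_le[of "{0..<k}" k "\<lambda>i l. M $$ (i, l)"] by simp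
  also have "\<dots> = (\<Prod>i<k. real k)"
  proof (rule prod.cong, goal_cases)
    case (2 i)
    have "M $$ (i, l) * M $$ (i, l) = 1" if "l < k" for l
      using sgn[of i l] 2 that by auto
    then show ?case
      by simp
  qed simp
  also have "\<dots> = (real k powr (real k / 2))\<^sup>2"
    using k by (simp add: powr_power powr_realpow)
  finally show ?thesis
    using abs_le_square_iff[of "det M" "real k powr (real k / 2)"] by simp
qed

section \<open>Integrality of determinants and divisibility by powers of two\<close>

lemma det_in_Ints:
  fixes M :: "real mat"
  assumes M: "M \<in> carrier_mat k k"
    and "\<And>i j. i < k \<Longrightarrow> j < k \<Longrightarrow> M $$ (i, j) \<in> \<int>"
  shows "det M \<in> \<int>"
proof -
  have "(\<Prod>i = 0..<k. M $$ (i, p i)) \<in> \<int>" if "p permutes {0..<k}" for p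
    by (rule Ints_prod) (use assms(2) permutes_in_image[OF that] in auto)
  then show ?thesis
    unfolding det_def'[OF M] by (intro Ints_sum Ints_mult) auto
qed

text \<open>Clearing the first column with multiples 1 or -1 of the first row leaves entries -2, 0
  and 2 in the complementary block, and each of its \<open>k\<close> rows contributes a factor
  2.\<close>

lemma det_sign_matrix_divisible:
  fixes M :: "real mat"
  assumes M: "M \<in> carrier_mat (Suc k) (Suc k)"
    and sgn: "\<And>i j. i \<le> k \<Longrightarrow> j \<le> k \<Longrightarrow> M $$ (i, j) \<in> {-1, 1}"
  shows "det M / 2 ^ k \<in> \<int>"
proof -
  \<comment> \<open>A sign is its own inverse, so this product is the quotient of the two entries of
    the first column.\<close>
  define c where "c = (\<lambda>i. M $$ (i, 0) * M $$ (0, 0))"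
  define N where "N = mat k k (\<lambda>(i, j). (M $$ (Suc i, Suc j) - c (Suc i) * M $$ (0, Suc j)) / 2)"
  have "det M = M $$ (0, 0) * det (mat k k (\<lambda>(i, j). M $$ (Suc i, Suc j) - c (Suc i) * M $$ (0, Suc j)))"
    by (rule det_schur_complement[OF M]) (use sgn[of 0 0] in \<open>auto simp: c_def\<close>)
  also have "mat k k (\<lambda>(i, j). M $$ (Suc i, Suc j) - c (Suc i) * M $$ (0, Suc j)) = 2 \<cdot>\<^sub>m N"
    by (rule eq_matI) (auto simp: N_def)
  finally have "det M / 2 ^ k = M $$ (0, 0) * det N"
    by (simp add: N_def)
  moreover have "N $$ (i, j) \<in> \<int>" if ij: "i < k" "j < k" for i j
  proof -
    have "M $$ (Suc i, Suc j) \<in> {-1, 1}" "M $$ (Suc i, 0) \<in> {-1, 1}" "M $$ (0, 0) \<in> {-1, 1}" "M $$ (0, Suc j) \<in> {-1, 1}"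
      using sgn ij by auto
    then show ?thesis
      using ij by (auto simp: N_def c_def)
  qed
  then have "det N \<in> \<int>"
    by (intro det_in_Ints[of N k]) (auto simp: N_def)
  moreover have "M $$ (0, 0) \<in> \<int>"
    using sgn[of 0 0] by auto
  ultimately show ?thesis
    by simp
qed

text \<open>
  The point \<open>s k\<close> is chosen last: expanding along its column, the determinant is a combination of the
  functions \<open>g i\<close> in which the coefficient of \<open>g k\<close> is the minor already known to be nonzero.
\<close>

lemma exists_nonsingular_minor:
  fixes g :: "nat \<Rightarrow> 'x \<Rightarrow> 'a :: idom"
  assumes indep: "\<And>c. (\<And>x. x \<in> X \<Longrightarrow> (\<Sum>i<k. c i * g i x) = 0) \<Longrightarrow> (\<forall>i<k. c i = 0)"
  shows "\<exists>s. (\<forall>j<k. s j \<in> X) \<and> det (mat k k (\<lambda>(i, j). g i (s j))) \<noteq> 0"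
  using indep
proof (induction k)
  case 0
  then show ?case
    by simp
next
  case (Suc k)
  have "\<forall>i<k. c i = 0" if "\<And>x. x \<in> X \<Longrightarrow> (\<Sum>i<k. c i * g i x) = 0" for c
  proof -
    have "\<forall>i<Suc k. (if i < k then c i else 0) = 0"
      by (rule Suc.prems) (simp add: that)
    then show ?thesis
      by (metis less_SucI)
  qed
  from Suc.IH[OF this] obtain s where s: "\<forall>j<k. s j \<in> X" "det (mat k k (\<lambda>(i, j). g i (s j))) \<noteq> 0"
    by blast
  define M where "M = (\<lambda>x. mat (Suc k) (Suc k) (\<lambda>(i, j). g i ((s(k := x)) j)))"
  have M: "M x \<in> carrier_mat (Suc k) (Suc k)" for x
    by (simp add: M_def)
  define c where "c = (\<lambda>i. (-1) ^ (i + k) * det (mat k k (\<lambda>(i', j). g (if i' < i then i' else Suc i') (s j))))"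
  \<comment> \<open>Deleting column \<open>k\<close> removes the only column that depends on
    \<open>x\<close>.\<close>
  have "cofactor (M x) i k = c i" if "i < Suc k" for i x
  proof -
    have "mat_delete (M x) i k = mat k k (\<lambda>(i', j). g (if i' < i then i' else Suc i') (s j))"
      by (rule eq_matI) (auto simp: M_def mat_delete_def)
    then show ?thesis
      by (simp add: cofactor_def c_def)
  qed
  then have det_M: "det (M x) = (\<Sum>i<Suc k. c i * g i x)" for x
    unfolding laplace_expansion_column[OF M lessI]
    by (intro sum.cong) (auto simp: M_def)
  have "mat k k (\<lambda>(i', j). g (if i' < k then i' else Suc i') (s j)) = mat k k (\<lambda>(i, j). g i (s j))"
    by (rule eq_matI) auto
  then have "c k \<noteq> 0"
    using s(2) by (simp add: c_def)
  then obtain x where "x \<in> X" "det (M x) \<noteq> 0"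
    using Suc.prems[of c] det_M lessI by metis
  then show ?case
    using s(1) by (intro exI[of _ "s(k := x)"]) (auto simp: M_def less_Suc_eq)
qed

section \<open>Cramer's rule and integral annihilating vectors\<close>

text \<open>This is Cramer's rule without division, for a row vector acting from the left. Expanding
  along the replaced row identifies the determinants with the entries of \<open>r\<close> times the
  adjugate of \<open>M\<close>, and the adjugate times \<open>M\<close> is \<open>det M\<close>
  times the identity.\<close>

lemma cramer_row:
  fixes M :: "'a :: comm_ring_1 mat"
  assumes M: "M \<in> carrier_mat k k" and j: "j < k"
  shows "(\<Sum>i<k. det (mat k k (\<lambda>(i', j'). if i' = i then r j' else M $$ (i', j'))) * M $$ (i, j)) = det M * r j"
proof -
  have D: "det (mat k k (\<lambda>(i', j'). if i' = i then r j' else M $$ (i', j'))) = (\<Sum>l<k. r l * cofactor M i l)"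
    (is "det ?N = _") if i: "i < k" for i
  proof -
    have "det ?N = (\<Sum>l<k. ?N $$ (i, l) * cofactor ?N i l)"
      by (rule laplace_expansion_row[OF _ i]) simp
    also have "\<dots> = (\<Sum>l<k. r l * cofactor M i l)"
    proof (rule sum.cong, goal_cases)
      case (2 l)
      have "mat_delete ?N i l = mat_delete M i l"
        by (rule eq_matI) (use M i 2 in \<open>auto simp: mat_delete_def\<close>)
      then show ?case
        using i 2 by (simp add: cofactor_def)
    qed simp
    finally show ?thesis .
  qed
  have "(\<Sum>i<k. det (mat k k (\<lambda>(i', j'). if i' = i then r j' else M $$ (i', j'))) * M $$ (i, j))
      = (\<Sum>i<k. (\<Sum>l<k. r l * cofactor M i l) * M $$ (i, j))"
    by (simp add: D)
  also have "\<dots> = (\<Sum>l<k. r l * (\<Sum>i<k. cofactor M i l * M $$ (i, j)))"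
    unfolding sum_distrib_left sum_distrib_right by (subst sum.swap) (simp add: mult.assoc)
  also have "\<dots> = (\<Sum>l<k. r l * (if l = j then det M else 0))"
  proof (rule sum.cong, goal_cases)
    case (2 l)
    have "(adj_mat M * M) $$ (l, j) = (det M \<cdot>\<^sub>m 1\<^sub>m k) $$ (l, j)"
      using adj_mat(3)[OF M] by simp
    moreover have "(adj_mat M * M) $$ (l, j) = (\<Sum>i<k. cofactor M i l * M $$ (i, j))"
      using M adj_mat(1)[OF M] 2 j
      by (simp add: scalar_prod_def adj_mat_def atLeast0LessThan)
    ultimately show ?case
      using 2 j by simp
  qed simp
  also have "\<dots> = det M * r j"
    using j by (simp add: if_distrib[of "\<lambda>x. _ * x"] mult.commute cong: if_cong)
  finally show ?thesis .
qed

text \<open>The values on \<open>B\<close> are a positive multiple of the prescribed signs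
  \<open>b\<close>; the values on \<open>A\<close> then solve a square system whose matrix is a
  nonsingular minor of the independent rows indexed by \<open>A\<close>. All determinants in
  Cramer's rule are those of sign matrices, so a common factor \<open>2 ^ k\<close> can be removed.
  Superposing one solution for each point of \<open>B\<close> costs the factor \<open>Suc k\<close>
  in the bound.\<close>

lemma integral_annihilator:
  fixes \<chi> :: "'x \<Rightarrow> 'y \<Rightarrow> real" and b :: "'y \<Rightarrow> real"
  assumes A: "finite A" "card A = Suc k" and B: "finite B" "card B = Suc k" and disj: "A \<inter> B = {}"
    and \<chi>: "\<And>S y. S \<in> X \<Longrightarrow> y \<in> A \<union> B \<Longrightarrow> \<chi> S y \<in> {-1, 1}"
    and b: "\<And>y. y \<in> B \<Longrightarrow> b y \<in> {-1, 1}"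
    and indep: "\<And>c. (\<And>S. S \<in> X \<Longrightarrow> (\<Sum>y\<in>A. c y * \<chi> S y) = 0) \<Longrightarrow> (\<forall>y\<in>A. c y = 0)"
  obtains Z U where "Z \<subseteq> X" "card Z = Suc k" "\<And>S. S \<in> Z \<Longrightarrow> (\<Sum>y\<in>A \<union> B. U y * \<chi> S y) = 0"
    "\<And>y. y \<in> A \<union> B \<Longrightarrow> U y \<in> \<int>"
    "\<And>y. y \<in> A \<union> B \<Longrightarrow> \<bar>U y\<bar> \<le> real (Suc k) * (real (Suc k) powr (real (Suc k) / 2) / 2 ^ k)"
    "\<And>y. y \<in> B \<Longrightarrow> b y * U y > 0"
proof -
  define Q where "Q = real (Suc k) powr (real (Suc k) / 2) / 2 ^ k"
  obtain e where e: "bij_betw e {..<Suc k} A"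
    using ex_bij_betw_nat_finite[OF A(1)] A(2) by (auto simp: atLeast0LessThan)
  then have eA: "e i \<in> A" if "i < Suc k" for i
    using that by (auto simp: bij_betw_def)
  define e' where "e' = the_inv_into {..<Suc k} e"
  have e'_e: "e' (e i) = i" if "i < Suc k" for i
    using e that by (simp add: e'_def bij_betw_def the_inv_into_f_f)
  have e'_lt: "e' y < Suc k" if "y \<in> A" for y
    using bij_betw_the_inv_into[OF e] that unfolding e'_def bij_betw_def by blast
  have "\<forall>i<Suc k. c i = 0" if *: "\<And>S. S \<in> X \<Longrightarrow> (\<Sum>i<Suc k. c i * \<chi> S (e i)) = 0" for c
  proof -
    have "(\<Sum>y\<in>A. c (e' y) * \<chi> S y) = (\<Sum>i<Suc k. c i * \<chi> S (e i))" for S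
      by (subst sum.reindex_bij_betw[OF e, symmetric]) (intro sum.cong refl, simp add: e'_e)
    then have "\<forall>y\<in>A. c (e' y) = 0"
      using indep[of "\<lambda>y. c (e' y)"] * by simp
    then show ?thesis
      using e'_e eA by metis
  qed
  from exists_nonsingular_minor[where X = X and k = "Suc k" and g = "\<lambda>i S. \<chi> S (e i)", OF this]
  obtain s where s: "\<And>j. j < Suc k \<Longrightarrow> s j \<in> X"
    and nz: "det (mat (Suc k) (Suc k) (\<lambda>(i, j). \<chi> (s j) (e i))) \<noteq> 0"
    by blast
  define M where "M = mat (Suc k) (Suc k) (\<lambda>(i, j). \<chi> (s j) (e i))"
  have M: "M \<in> carrier_mat (Suc k) (Suc k)"
    by (simp add: M_def)
  \<comment> \<open>The minor is nonsingular, so no column is repeated and \<open>s\<close> selects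
    \<open>Suc k\<close> different elements of \<open>X\<close>.\<close>
  have "inj_on s {..<Suc k}"
  proof (rule inj_onI, rule ccontr)
    fix i j assume ij: "i \<in> {..<Suc k}" "j \<in> {..<Suc k}" "s i = s j" "i \<noteq> j"
    then have "col M i = col M j"
      by (auto simp: M_def)
    then have "det M = 0"
      using ij by (intro det_identical_columns[OF M, of i j]) auto
    then show False
      using nz by (simp add: M_def)
  qed
  then have card_Z: "card (s ` {..<Suc k}) = Suc k"
    by (simp add: card_image)
  have det_sign: "det N / 2 ^ k \<in> \<int> \<and> \<bar>det N / 2 ^ k\<bar> \<le> Q"
    if "N \<in> carrier_mat (Suc k) (Suc k)" "\<And>i j. i < Suc k \<Longrightarrow> j < Suc k \<Longrightarrow> N $$ (i, j) \<in> {-1, 1}" for N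
    using det_sign_matrix_divisible[of N k] hadamard_sign_matrix[of "Suc k" N] that
    by (simp add: Q_def divide_right_mono less_Suc_eq_le)
  \<comment> \<open>Cramer's numerators: row \<open>i\<close> of the minor is replaced by the row of
    the point \<open>y\<close>.\<close>
  define D where "D = (\<lambda>y i. det (mat (Suc k) (Suc k) (\<lambda>(i', j). if i' = i then \<chi> (s j) y else M $$ (i', j))))"
  have M_sign: "M $$ (i, j) \<in> {-1, 1}" if "i < Suc k" "j < Suc k" for i j
    using \<chi>[OF s[OF that(2)], of "e i"] eA[OF that(1)] that by (simp add: M_def)
  have D: "D y i / 2 ^ k \<in> \<int> \<and> \<bar>D y i / 2 ^ k\<bar> \<le> Q" if "y \<in> B" for y i
    unfolding D_def
  proof (rule det_sign, goal_cases)
    case (2 i' j)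
    then show ?case
      using M_sign[OF 2] \<chi>[OF s[OF 2(2)], of y] that by simp
  qed simp
  \<comment> \<open>The natural scale is \<open>det M / 2 ^ k\<close>. The factor
    \<open>\<sigma>\<close> makes it positive, so that \<open>U\<close> keeps the signs of
    \<open>b\<close> on \<open>B\<close>.\<close>
  define q where "q = \<bar>det M / 2 ^ k\<bar>"
  define \<sigma> where "\<sigma> = sgn (det M)"
  have q: "q \<in> \<int>" "q \<le> Q" "q > 0"
    using det_sign[OF M M_sign] nz by (simp_all add: q_def M_def Ints_abs del: abs_divide)
  have \<sigma>: "\<sigma> \<in> {-1, 1}" "\<sigma> * (det M / 2 ^ k) = q"
    using nz by (auto simp: q_def \<sigma>_def M_def sgn_if)
  define U where "U = (\<lambda>y. if y \<in> B then q * b y else - \<sigma> * (\<Sum>z\<in>B. b z * (D z (e' y) / 2 ^ k)))"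
  have b_abs: "\<bar>b y\<bar> = 1" if "y \<in> B" for y
    using b[OF that] by auto
  have b_Ints: "b y \<in> \<int>" if "y \<in> B" for y
    using b[OF that] by auto
  show thesis
  proof (rule that[of "s ` {..<Suc k}" U])
    show "s ` {..<Suc k} \<subseteq> X"
      using s by auto
    show "card (s ` {..<Suc k}) = Suc k"
      by (rule card_Z)
  next
    fix S assume "S \<in> s ` {..<Suc k}"
    then obtain j where j: "j < Suc k" "S = s j"
      by auto
    have "(\<Sum>y\<in>A. U y * \<chi> S y) = (\<Sum>i<Suc k. U (e i) * \<chi> S (e i))"
      by (rule sum.reindex_bij_betw[OF e, symmetric])
    also have "\<dots> = (\<Sum>i<Suc k. (- \<sigma> * (\<Sum>z\<in>B. b z * (D z i / 2 ^ k))) * M $$ (i, j))"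
    proof (rule sum.cong, goal_cases)
      case (2 i)
      then have "e i \<notin> B"
        using eA disj by auto
      then show ?case
        using 2 j e'_e by (simp add: U_def M_def)
    qed simp
    also have "\<dots> = - \<sigma> * (\<Sum>z\<in>B. b z * ((\<Sum>i<Suc k. D z i * M $$ (i, j)) / 2 ^ k))"
      unfolding sum_distrib_left sum_distrib_right sum_divide_distrib
      by (subst sum.swap) (intro sum.cong refl, simp)
    \<comment> \<open>By Cramer's rule the inner sums are multiples of the rows of \<open>B\<close>,
      which then cancel against the contribution of \<open>B\<close> itself.\<close>
    also have "\<dots> = - \<sigma> * (\<Sum>z\<in>B. b z * ((det M * \<chi> (s j) z) / 2 ^ k))"
      unfolding D_def using cramer_row[OF M j(1)] by simp
    also have "\<dots> = - (\<Sum>z\<in>B. (\<sigma> * (det M / 2 ^ k)) * b z * \<chi> S z)"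
      unfolding sum_distrib_left j sum_negf[symmetric] by (intro sum.cong refl) simp
    also have "\<dots> = - (\<Sum>z\<in>B. U z * \<chi> S z)"
      unfolding \<sigma>(2) by (simp add: U_def)
    finally show "(\<Sum>y\<in>A \<union> B. U y * \<chi> S y) = 0"
      using A B disj by (simp add: sum.union_disjoint)
  next
    fix y assume "y \<in> A \<union> B"
    have "\<sigma> \<in> \<int>"
      using \<sigma>(1) by auto
    then show "U y \<in> \<int>"
      unfolding U_def using q b_Ints D by (auto intro!: Ints_mult Ints_sum Ints_minus simp del: times_divide_eq_right)
    have "\<bar>U y\<bar> \<le> (\<Sum>z\<in>B. Q)"
    proof (cases "y \<in> B")
      case True
      then have "\<bar>U y\<bar> = q"
        using q b_abs by (simp add: U_def abs_mult)
      also have "\<dots> \<le> Q"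
        by (rule q)
      \<comment> \<open>\<open>B\<close> is nonempty and \<open>Q\<close> is positive.\<close>
      also have "\<dots> \<le> (\<Sum>z\<in>B. Q)"
        using B q by (simp add: mult_le_cancel_right1)
      finally show ?thesis .
    next
      case False
      have "\<bar>U y\<bar> = \<bar>\<Sum>z\<in>B. b z * (D z (e' y) / 2 ^ k)\<bar>"
        using \<sigma>(1) False by (auto simp: U_def)
      also have "\<dots> \<le> (\<Sum>z\<in>B. \<bar>b z * (D z (e' y) / 2 ^ k)\<bar>)"
        by (rule sum_abs)
      also have "\<dots> \<le> (\<Sum>z\<in>B. Q)"
        using D by (intro sum_mono) (simp add: abs_mult b_abs)
      finally show ?thesis .
    qed
    then show "\<bar>U y\<bar> \<le> real (Suc k) * (real (Suc k) powr (real (Suc k) / 2) / 2 ^ k)"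
      by (simp add: B Q_def)
  next
    fix y assume y: "y \<in> B"
    then show "b y * U y > 0"
      using b[OF y] q by (auto simp: U_def)
  qed
qed

section \<open>Characters of the hypercube\<close>

text \<open>The Walsh characters, which are the monomials of \<open>multilinear\<close>.\<close>

definition character :: "nat set \<Rightarrow> (nat \<Rightarrow> real) \<Rightarrow> real" where
  "character S x = (\<Prod>k\<in>S. x k)"

lemma finite_cube: "finite (cube n)"
  by (simp add: cube_def finite_PiE)

lemma card_cube: "card (cube n) = 2 ^ n"
  by (simp add: cube_def card_PiE numeral_2_eq_2)

lemma cube_sign:
  assumes "x \<in> cube n" "k \<in> {1..n}"
  shows "x k \<in> {-1, 1}"
  using assms unfolding cube_def by (rule PiE_mem)

lemma character_sign:
  assumes x: "x \<in> cube n" and S: "S \<subseteq> {1..n}"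
  shows "character S x \<in> {-1, 1}"
proof -
  have "finite S"
    using S finite_subset by blast
  then show ?thesis
    using S
  proof (induction S)
    case (insert k S)
    then show ?case
      using cube_sign[OF x, of k] by (auto simp: character_def)
  qed (simp add: character_def)
qed

text \<open>The sum over all subsets factorizes into the product of \<open>x k * y k + 1\<close>; a
  coordinate in which the points differ makes its factor zero, and all other factors are 2.\<close>

lemma character_orthogonal:
  assumes x: "x \<in> cube n" and y: "y \<in> cube n"
  shows "(\<Sum>S\<in>Pow {1..n}. character S x * character S y) = (if x = y then 2 ^ n else 0)"
proof -
  have "(\<Sum>S\<in>Pow {1..n}. character S x * character S y) = (\<Prod>k\<in>{1..n}. x k * y k + 1)"
    by (simp add: prod_add character_def prod.distrib)
  also have "\<dots> = (if x = y then 2 ^ n else 0)"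
  proof (cases "x = y")
    case True
    have "x k * x k + 1 = 2" if "k \<in> {1..n}" for k
      using cube_sign[OF x that] by auto
    then show ?thesis
      using True by simp
  next
    case False
    then obtain k where k: "k \<in> {1..n}" "x k \<noteq> y k"
      using x y unfolding cube_def by (meson PiE_ext)
    then have "x k * y k + 1 = 0"
      using cube_sign[OF x k(1)] cube_sign[OF y k(1)] by auto
    then have "(\<Prod>k\<in>{1..n}. x k * y k + 1) = 0"
      using k(1) by (meson finite_atLeastAtMost prod_zero)
    then show ?thesis
      using False by simp
  qed
  finally show ?thesis .
qed

text \<open>Fourier inversion on the cube, up to the factor \<open>2 ^ n\<close>. It also yields the
  linear independence of the rows of the character matrix.\<close>

lemma character_expansion:
  assumes A: "A \<subseteq> cube n" and x: "x \<in> cube n"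
  shows "(\<Sum>S\<in>Pow {1..n}. (\<Sum>y\<in>A. c y * character S y) * character S x) = (if x \<in> A then 2 ^ n * c x else 0)"
proof -
  have "(\<Sum>S\<in>Pow {1..n}. (\<Sum>y\<in>A. c y * character S y) * character S x)
      = (\<Sum>y\<in>A. c y * (\<Sum>S\<in>Pow {1..n}. character S y * character S x))"
    unfolding sum_distrib_left sum_distrib_right by (subst sum.swap) (simp add: mult.assoc)
  also have "\<dots> = (\<Sum>y\<in>A. if y = x then 2 ^ n * c x else 0)"
    by (rule sum.cong) (use A x character_orthogonal in auto)
  also have "\<dots> = (if x \<in> A then 2 ^ n * c x else 0)"
    using finite_subset[OF A finite_cube] by simp
  finally show ?thesis .
qed

lemma cube_integral_annihilator:
  assumes A: "A \<subseteq> cube (Suc m)" "card A = 2 ^ m"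
    and b: "\<And>y. y \<in> cube (Suc m) \<Longrightarrow> b y \<in> {-1, 1 :: real}"
  obtains Z U where "Z \<subseteq> Pow {1..Suc m}" "card Z = 2 ^ m"
    "\<And>S. S \<in> Z \<Longrightarrow> (\<Sum>y\<in>cube (Suc m). U y * character S y) = 0"
    "\<And>y. y \<in> cube (Suc m) \<Longrightarrow> U y \<in> \<int>"
    "\<And>y. y \<in> cube (Suc m) \<Longrightarrow> \<bar>U y\<bar> \<le> 2 ^ m * ((2 ^ m) powr (2 ^ m / 2) / 2 ^ (2 ^ m - 1))"
    "\<And>y. y \<in> cube (Suc m) - A \<Longrightarrow> b y * U y > 0"
proof -
  \<comment> \<open>The general lemma takes sets of size \<open>Suc k\<close>; here that size is
    half of the cube \<open>cube (Suc m)\<close>.\<close>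
  define k where "k = (2 :: nat) ^ m - 1"
  have k: "Suc k = 2 ^ m"
    by (simp add: k_def)
  have finA: "finite A"
    using A finite_cube finite_subset by blast
  have union: "A \<union> (cube (Suc m) - A) = cube (Suc m)"
    using A by blast
  have card_diff: "card (cube (Suc m) - A) = Suc k"
    using A finA by (simp add: card_Diff_subset card_cube k)
  have indep: "\<forall>y\<in>A. c y = 0" if "\<And>S. S \<in> Pow {1..Suc m} \<Longrightarrow> (\<Sum>y\<in>A. c y * character S y) = 0" for c
  proof
    fix y assume y: "y \<in> A"
    have "(\<Sum>S\<in>Pow {1..Suc m}. (\<Sum>y\<in>A. c y * character S y) * character S y) = 0"
      using that by (intro sum.neutral) simp
    then show "c y = 0"
      using character_expansion[OF A(1), of y c] A(1) y by auto
  qed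
  have card_A: "card A = Suc k"
    using A(2) k by simp
  show thesis
  proof (rule integral_annihilator[OF finA card_A finite_Diff[OF finite_cube] card_diff])
    show "A \<inter> (cube (Suc m) - A) = {}"
      by blast
    show "character S y \<in> {-1, 1}" if "S \<in> Pow {1..Suc m}" "y \<in> A \<union> (cube (Suc m) - A)" for S y
      using that unfolding union by (intro character_sign) auto
    show "b y \<in> {-1, 1}" if "y \<in> cube (Suc m) - A" for y
      using that b by blast
    show "\<forall>y\<in>A. c y = 0" if "\<And>S. S \<in> Pow {1..Suc m} \<Longrightarrow> (\<Sum>y\<in>A. c y * character S y) = 0" for c
      by (rule indep) (rule that)
  next
    fix Z U
    assume "Z \<subseteq> Pow {1..Suc m}" "card Z = Suc k"
      "\<And>S. S \<in> Z \<Longrightarrow> (\<Sum>y\<in>A \<union> (cube (Suc m) - A). U y * character S y) = 0"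
      "\<And>y. y \<in> A \<union> (cube (Suc m) - A) \<Longrightarrow> U y \<in> \<int>"
      "\<And>y. y \<in> A \<union> (cube (Suc m) - A) \<Longrightarrow> \<bar>U y\<bar> \<le> real (Suc k) * (real (Suc k) powr (real (Suc k) / 2) / 2 ^ k)"
      "\<And>y. y \<in> cube (Suc m) - A \<Longrightarrow> b y * U y > 0"
    then show thesis
      unfolding union k of_nat_power of_nat_numeral unfolding k_def by (rule that)
  qed
qed

text \<open>
  The coefficients of \<open>P y + t * R y\<close>, where \<open>t\<close> is the variable with index \<open>Suc n\<close>. They are scaled
  by \<open>2 ^ n\<close>, which makes them integral when \<open>P\<close> and \<open>R\<close> are.
\<close>

definition glued_coeffs :: "nat \<Rightarrow> ((nat \<Rightarrow> real) \<Rightarrow> real) \<Rightarrow> ((nat \<Rightarrow> real) \<Rightarrow> real) \<Rightarrow> nat set \<Rightarrow> real" where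
  "glued_coeffs n P R S =
    (if Suc n \<in> S then \<Sum>y\<in>cube n. R y * character (S - {Suc n}) y else \<Sum>y\<in>cube n. P y * character S y)"

text \<open>The subsets of \<open>{1..Suc n}\<close> split into those without and those with
  \<open>Suc n\<close>. Fourier inversion applied to each half recovers \<open>P y\<close> and
  \<open>t * R y\<close>.\<close>

lemma multilinear_glued_coeffs:
  assumes y: "y \<in> cube n"
  shows "multilinear (Suc n) (glued_coeffs n P R) (y(Suc n := t)) = 2 ^ n * (P y + t * R y)"
proof -
  let ?g = "\<lambda>S. glued_coeffs n P R S * (\<Prod>k\<in>S. (y(Suc n := t)) k)"
  have notin: "Suc n \<notin> S" if "S \<in> Pow {1..n}" for S
    using that by auto
  have inj: "inj_on (insert (Suc n)) (Pow {1..n})"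
    by (rule inj_onI) (use notin in \<open>metis insert_ident\<close>)
  have restrict: "(\<Prod>k\<in>S. (y(Suc n := t)) k) = character S y" if "S \<in> Pow {1..n}" for S
    unfolding character_def by (rule prod.cong) (use notin[OF that] in auto)
  have "{1..Suc n} = insert (Suc n) {1..n}"
    by auto
  then have "multilinear (Suc n) (glued_coeffs n P R) (y(Suc n := t)) = sum ?g (Pow {1..n} \<union> insert (Suc n) ` Pow {1..n})"
    by (simp only: multilinear_def Pow_insert)
  also have "\<dots> = sum ?g (Pow {1..n}) + sum ?g (insert (Suc n) ` Pow {1..n})"
    by (rule sum.union_disjoint) auto
  also have "sum ?g (Pow {1..n}) = (\<Sum>S\<in>Pow {1..n}. (\<Sum>y\<in>cube n. P y * character S y) * character S y)"
    by (rule sum.cong) (use notin restrict in \<open>simp_all add: glued_coeffs_def\<close>)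
  also have "sum ?g (insert (Suc n) ` Pow {1..n}) = (\<Sum>S\<in>Pow {1..n}. ?g (insert (Suc n) S))"
    unfolding sum.reindex[OF inj] comp_def ..
  also have "\<dots> = (\<Sum>S\<in>Pow {1..n}. t * ((\<Sum>y\<in>cube n. R y * character S y) * character S y))"
  proof (rule sum.cong, goal_cases)
    case (2 S)
    then have "finite S"
      using finite_subset by auto
    then have "(\<Prod>k\<in>insert (Suc n) S. (y(Suc n := t)) k) = t * character S y"
      using notin[OF 2] restrict[OF 2] by simp
    then show ?case
      using notin[OF 2] by (simp add: glued_coeffs_def)
  qed simp
  also have "\<dots> = t * (\<Sum>S\<in>Pow {1..n}. (\<Sum>y\<in>cube n. R y * character S y) * character S y)"
    by (rule sum_distrib_left[symmetric])
  finally show ?thesis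
    using y by (simp only: character_expansion[OF order_refl y]) (simp add: algebra_simps)
qed

lemma glued_coeffs_bound:
  assumes P: "\<And>y. y \<in> cube n \<Longrightarrow> P y \<in> \<int> \<and> \<bar>P y\<bar> \<le> C"
    and R: "\<And>y. y \<in> cube n \<Longrightarrow> R y \<in> \<int> \<and> \<bar>R y\<bar> \<le> C"
    and S: "S \<subseteq> {1..Suc n}"
  shows "glued_coeffs n P R S \<in> \<int> \<and> \<bar>glued_coeffs n P R S\<bar> \<le> 2 ^ n * C"
proof -
  have sum_bound: "(\<Sum>y\<in>cube n. F y * character T y) \<in> \<int> \<and> \<bar>\<Sum>y\<in>cube n. F y * character T y\<bar> \<le> 2 ^ n * C"
    if F: "\<And>y. y \<in> cube n \<Longrightarrow> F y \<in> \<int> \<and> \<bar>F y\<bar> \<le> C" and T: "T \<subseteq> {1..n}" for F T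
  proof
    show "(\<Sum>y\<in>cube n. F y * character T y) \<in> \<int>"
    proof (intro Ints_sum Ints_mult)
      fix y assume y: "y \<in> cube n"
      show "F y \<in> \<int>" "character T y \<in> \<int>"
        using F[OF y] character_sign[OF y T] by auto
    qed
    have "\<bar>\<Sum>y\<in>cube n. F y * character T y\<bar> \<le> (\<Sum>y\<in>cube n. \<bar>F y * character T y\<bar>)"
      by (rule sum_abs)
    also have "\<dots> \<le> (\<Sum>y\<in>cube n. C)"
    proof (rule sum_mono)
      fix y assume y: "y \<in> cube n"
      show "\<bar>F y * character T y\<bar> \<le> C"
        using F[OF y] character_sign[OF y T] by (auto simp: abs_mult)
    qed
    finally show "\<bar>\<Sum>y\<in>cube n. F y * character T y\<bar> \<le> 2 ^ n * C"
      by (simp add: card_cube)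
  qed
  have "S - {Suc n} \<subseteq> {1..n}"
    using S by (auto simp: le_Suc_eq)
  moreover have "S \<subseteq> {1..n}" if "Suc n \<notin> S"
    using S that by (auto simp: le_Suc_eq)
  ultimately show ?thesis
    unfolding glued_coeffs_def using sum_bound[of P] sum_bound[of R] P R by auto
qed

section \<open>From the two components to a threshold representation\<close>

lemma cube_SucE:
  assumes x: "x \<in> cube (Suc n)"
  obtains y t where "y \<in> cube n" "t \<in> {-1, 1 :: real}" "x = y(Suc n := t)"
proof
  show "x (Suc n) \<in> {-1, 1}"
    by (rule cube_sign[OF x]) simp
  show "x(Suc n := undefined) \<in> cube n"
    using x by (auto simp: cube_def PiE_iff extensional_def)
qed simp

lemma cube_Suc:
  assumes "y \<in> cube n" "t \<in> {-1, 1}"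
  shows "y(Suc n := t) \<in> cube (Suc n)"
  using assms by (auto simp: cube_def PiE_iff extensional_def le_Suc_eq)

lemma sgn_eq_sign:
  fixes a p :: real
  assumes "a \<in> {-1, 1}" "a * p > 0"
  shows "a = sgn p"
  using assms by (auto simp: sgn_if)

text \<open>Reduces the theorem to choosing integral \<open>P\<close> and \<open>R\<close> with the
  right signs and a set \<open>Z\<close> of vanishing coefficients that makes up at least a quarter
  of all monomials.\<close>

lemma ptf_of_glued_coeffs:
  assumes f: "boolean_function (Suc n) f"
    and P: "\<And>y. y \<in> cube n \<Longrightarrow> P y \<in> \<int> \<and> \<bar>P y\<bar> \<le> C"
    and R: "\<And>y. y \<in> cube n \<Longrightarrow> R y \<in> \<int> \<and> \<bar>R y\<bar> \<le> C"
    and sgn: "\<And>y t. y \<in> cube n \<Longrightarrow> t \<in> {-1, 1} \<Longrightarrow> f (y(Suc n := t)) * (P y + t * R y) > 0"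
    and Z: "Z \<subseteq> Pow {1..Suc n}" "2 ^ Suc n \<le> 4 * card Z" "\<And>S. S \<in> Z \<Longrightarrow> glued_coeffs n P R S = 0"
  shows "\<exists>w. ptf_representation (Suc n) w f \<and> real (ptf_length (Suc n) w) \<le> 0.75 * 2 ^ Suc n \<and>
    (\<forall>S\<in>Pow {1..Suc n}. w S \<in> \<int> \<and> \<bar>w S\<bar> \<le> 2 ^ n * C)"
proof (intro exI conjI ballI)
  let ?w = "glued_coeffs n P R"
  show "ptf_representation (Suc n) ?w f"
    unfolding ptf_representation_def
  proof
    fix x assume x: "x \<in> cube (Suc n)"
    then obtain y t where y: "y \<in> cube n" and t: "t \<in> {-1, 1 :: real}" and xy: "x = y(Suc n := t)"
      by (rule cube_SucE)
    have fx: "f x \<in> {-1, 1}"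
      using f x by (auto simp: boolean_function_def)
    have eq: "f x * multilinear (Suc n) ?w x = 2 ^ n * (f x * (P y + t * R y))"
      unfolding xy multilinear_glued_coeffs[OF y] by (rule mult.left_commute)
    have pos: "2 ^ n * (f x * (P y + t * R y)) > 0"
      using sgn[OF y t] by (simp add: xy)
    show "f x = sgn (multilinear (Suc n) ?w x)"
      by (rule sgn_eq_sign[OF fx]) (simp only: eq pos)
  qed
  have finZ: "finite Z"
    using Z(1) finite_subset by blast
  have "ptf_length (Suc n) ?w \<le> card (Pow {1..Suc n} - Z)"
    unfolding ptf_length_def by (rule card_mono) (use Z(3) in auto)
  also have "\<dots> = 2 ^ Suc n - card Z"
    using finZ Z(1) by (simp add: card_Diff_subset card_Pow)
  finally have "4 * ptf_length (Suc n) ?w \<le> 3 * 2 ^ Suc n"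
    using Z(2) by linarith
  then have "real (4 * ptf_length (Suc n) ?w) \<le> real (3 * 2 ^ Suc n)"
    by (rule of_nat_mono)
  then show "real (ptf_length (Suc n) ?w) \<le> 0.75 * 2 ^ Suc n"
    by simp
  fix S assume "S \<in> Pow {1..Suc n}"
  then show "?w S \<in> \<int>" "\<bar>?w S\<bar> \<le> 2 ^ n * C"
    using glued_coeffs_bound[of n P C R S] P R by auto
qed

text \<open>On the left, \<open>2 ^ Suc m\<close> counts the points summed over, 2 absorbs the
  \<open>+ 1\<close> in the dominating component, and the rest bounds the annihilator. With
  \<open>m + 2\<close> variables the terms \<open>m * 2 ^ m / 2 - 2 ^ m\<close> of both exponents
  agree, and the right one exceeds the left one by \<open>2 * m + 5\<close>.\<close>

lemma coefficient_bound:
  "2 ^ Suc m * (2 * (2 ^ m * ((2 ^ m) powr (2 ^ m / 2) / 2 ^ (2 ^ m - 1))))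
    \<le> (2 :: real) powr (real (m + 2) * 2 powr (real (m + 2) - 3) - 2 powr (real (m + 2) - 1) + 4 * real (m + 2))"
proof -
  have powers: "2 powr (real m) = 2 ^ m"
    by (simp add: powr_realpow)
  have den: "(2 :: real) ^ (2 ^ m - 1) = 2 powr (2 ^ m - 1)"
    by (simp add: powr_realpow[symmetric] of_nat_diff)
  have num: "((2 :: real) ^ m) powr (2 ^ m / 2) = 2 powr (real m * (2 ^ m / 2))"
    unfolding powers[symmetric] powr_powr ..
  have factor: "(2 :: real) ^ Suc m * (2 * 2 ^ m) = 2 powr (real m + 1 + (1 + real m))"
    unfolding powr_add powers by simp
  have "2 ^ Suc m * (2 * (2 ^ m * ((2 ^ m) powr (2 ^ m / 2) / 2 ^ (2 ^ m - 1))))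
      = (2 :: real) ^ Suc m * (2 * 2 ^ m) * (2 ^ m) powr (2 ^ m / 2) / 2 ^ (2 ^ m - 1)"
    by (simp only: mult.assoc times_divide_eq_right)
  also have "\<dots> = (2 :: real) powr (real m + 1 + (1 + real m) + real m * (2 ^ m / 2) - (2 ^ m - 1))"
    unfolding den num factor by (simp only: powr_add powr_diff)
  also have "\<dots> \<le> 2 powr (real (m + 2) * 2 powr (real (m + 2) - 3) - 2 powr (real (m + 2) - 1) + 4 * real (m + 2))"
  proof (rule powr_mono)
    have "(2 :: real) powr (real (m + 2) - 3) = 2 powr (real m - 1)" "(2 :: real) powr (real (m + 2) - 1) = 2 powr (real m + 1)"
      by (simp_all add: algebra_simps)
    then have "(2 :: real) powr (real (m + 2) - 3) = 2 ^ m / 2" "(2 :: real) powr (real (m + 2) - 1) = 2 * 2 ^ m"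
      by (simp_all add: powr_diff powr_add powers)
    then show "real m + 1 + (1 + real m) + real m * (2 ^ m / 2) - (2 ^ m - 1)
        \<le> real (m + 2) * 2 powr (real (m + 2) - 3) - 2 powr (real (m + 2) - 1) + 4 * real (m + 2)"
      by (simp add: algebra_simps)
  qed simp
  finally show ?thesis .
qed

section \<open>One variable, and at least two variables\<close>

text \<open>Here \<open>2 ^ (n - 2)\<close> would be one half, so the general construction does not
  apply; \<open>f\<close> is a constant or plus or minus the variable, and one monomial
  suffices.\<close>

lemma ptf_one_variable:
  assumes f: "boolean_function (Suc 0) f"
  shows "\<exists>w. ptf_representation (Suc 0) w f \<and> real (ptf_length (Suc 0) w) \<le> 0.75 * 2 ^ Suc 0 \<and>
    (\<forall>S\<in>Pow {1..Suc 0}. w S \<in> \<int> \<and> \<bar>w S\<bar> \<le> 1)"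
proof -
  define e where "e = (\<lambda>k :: nat. undefined :: real)"
  have cube0: "cube 0 = {e}"
    by (simp add: cube_def e_def PiE_empty_domain)
  have f_sign: "f (e(Suc 0 := t)) \<in> {-1, 1}" if "t \<in> {-1, 1}" for t
    using f cube_Suc[of e 0 t] that by (auto simp: boolean_function_def cube0)
  have f1: "f (e(Suc 0 := 1)) \<in> {-1, 1}" and f2: "f (e(Suc 0 := -1)) \<in> {-1, 1}"
    using f_sign[of 1] f_sign[of "-1"] by auto
  show ?thesis
  proof (cases "f (e(Suc 0 := 1)) = f (e(Suc 0 := -1))")
    case True
    show ?thesis
      by (rule ptf_of_glued_coeffs[of 0 f "\<lambda>y. f (e(Suc 0 := 1))" 1 "\<lambda>y. 0" "{{Suc 0}}", unfolded power_0 mult_1])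
         (use f True f1 f2 in \<open>auto simp: cube0 glued_coeffs_def\<close>)
  next
    case False
    show ?thesis
      by (rule ptf_of_glued_coeffs[of 0 f "\<lambda>y. 0" 1 "\<lambda>y. f (e(Suc 0 := 1))" "{{}}", unfolded power_0 mult_1])
         (use f False f1 f2 in \<open>auto simp: cube0 glued_coeffs_def\<close>)
  qed
qed

lemma ptf_at_least_two_variables:
  assumes f: "boolean_function (Suc (Suc m)) f"
  shows "\<exists>w. ptf_representation (Suc (Suc m)) w f \<and> real (ptf_length (Suc (Suc m)) w) \<le> 0.75 * 2 ^ Suc (Suc m) \<and>
    (\<forall>S\<in>Pow {1..Suc (Suc m)}. w S \<in> \<int> \<and>
      \<bar>w S\<bar> \<le> 2 ^ Suc m * (2 * (2 ^ m * ((2 ^ m) powr (2 ^ m / 2) / 2 ^ (2 ^ m - 1)))))"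
proof -
  let ?n = "Suc m"
  define C :: real where "C = 2 ^ m * ((2 ^ m) powr (2 ^ m / 2) / 2 ^ (2 ^ m - 1))"
  define b where "b = (\<lambda>y. f (y(Suc ?n := 1)))"
  \<comment> \<open>The points at which \<open>f\<close> depends on the last variable
    \<open>t\<close>: there \<open>f\<close> equals \<open>t * b y\<close>, elsewhere it equals
    \<open>b y\<close>.\<close>
  define D where "D = {y \<in> cube ?n. f (y(Suc ?n := -1)) \<noteq> b y}"
  have f_sign: "f (y(Suc ?n := t)) \<in> {-1, 1}" if "y \<in> cube ?n" "t \<in> {-1, 1}" for y t
    using f cube_Suc[OF that] by (auto simp: boolean_function_def)
  have b_sign: "b y \<in> {-1, 1}" if "y \<in> cube ?n" for y
    using f_sign[OF that, of 1] by (simp add: b_def)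
  have f_in: "f (y(Suc ?n := t)) = t * b y" if "y \<in> D" "t \<in> {-1, 1}" for y t
    using f_sign[of y "-1"] b_sign[of y] that by (auto simp: D_def b_def)
  have f_out: "f (y(Suc ?n := t)) = b y" if "y \<in> cube ?n - D" "t \<in> {-1, 1}" for y t
    using that by (auto simp: D_def b_def)
  have D: "D \<subseteq> cube ?n"
    by (auto simp: D_def)
  \<comment> \<open>The second summand has the sign of \<open>a\<close> and outweighs the first by
    at least 1.\<close>
  have dominate: "a * (s * p + r * (\<bar>p\<bar> + 1)) > 0" if "a \<in> {-1, 1}" "s \<in> {-1, 1}" "r = a" for a s r p :: real
    using that by (auto simp: abs_if)
  have nonempty_diff: "\<exists>y. y \<in> cube ?n - A" if "A \<subseteq> cube ?n" "card A = 2 ^ m" for A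
  proof (rule ccontr)
    assume "\<not> ?thesis"
    then have "A = cube ?n"
      using that by blast
    then show False
      using that by (simp add: card_cube)
  qed
  \<comment> \<open>Outside \<open>A\<close> the integer \<open>U y\<close> is nonzero, hence of
    modulus at least 1, and \<open>C\<close> bounds it. This lets \<open>2 * C\<close> bound
    \<open>\<bar>U y\<bar> + 1\<close>.\<close>
  have C_ge: "C \<ge> 1" if "A \<subseteq> cube ?n" "card A = 2 ^ m" "\<And>y. y \<in> cube ?n \<Longrightarrow> U y \<in> \<int> \<and> \<bar>U y\<bar> \<le> C"
    "\<And>y. y \<in> cube ?n - A \<Longrightarrow> b y * U y > 0" for A U
  proof -
    from nonempty_diff[OF that(1,2)] obtain y where y: "y \<in> cube ?n - A" ..
    have Uy: "U y \<in> \<int>" "\<bar>U y\<bar> \<le> C"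
      using that(3)[of y] y by blast+
    have "U y \<noteq> 0"
      using that(4)[OF y] by force
    with Uy(1) have "1 \<le> \<bar>U y\<bar>"
      by (rule Ints_nonzero_abs_ge1)
    then show ?thesis
      using Uy(2) by (rule order_trans)
  qed
  have Pow_Suc: "S \<in> Pow {1..Suc ?n}" "insert (Suc ?n) S \<in> Pow {1..Suc ?n}" "Suc ?n \<notin> S"
    if "S \<in> Pow {1..?n}" for S
    using that subset_trans[of S "{1..?n}" "{1..Suc ?n}"] by auto
  have "card D + card (cube ?n - D) = 2 * 2 ^ m"
    using card_mono[OF finite_cube D] finite_subset[OF D finite_cube] by (simp add: card_Diff_subset[OF _ D] card_cube)
  then consider "2 ^ m \<le> card D" | "2 ^ m \<le> card (cube ?n - D)"
    by linarith
  then show ?thesis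
  proof cases
    case 1
    then obtain A where A: "A \<subseteq> D" "card A = 2 ^ m"
      by (meson obtain_subset_with_card_n)
    have A_cube: "A \<subseteq> cube ?n"
      using A(1) D by blast
    obtain Z U where Z: "Z \<subseteq> Pow {1..?n}" "card Z = 2 ^ m"
      and ZU: "\<And>S. S \<in> Z \<Longrightarrow> (\<Sum>y\<in>cube ?n. U y * character S y) = 0"
      and U_Ints: "\<And>y. y \<in> cube ?n \<Longrightarrow> U y \<in> \<int>"
      and U_le: "\<And>y. y \<in> cube ?n \<Longrightarrow> \<bar>U y\<bar> \<le> C"
      and U_pos: "\<And>y. y \<in> cube ?n - A \<Longrightarrow> b y * U y > 0"
      by (rule cube_integral_annihilator[OF A_cube A(2) b_sign, folded C_def]) (assumption, rule that)
    have C1: "C \<ge> 1"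
      using C_ge[OF A_cube A(2), of U] U_Ints U_le U_pos by blast
    \<comment> \<open>\<open>U\<close> serves as the component free of \<open>t\<close>. On
      \<open>D\<close> it is dominated by \<open>R\<close>; outside \<open>D\<close>, hence outside
      \<open>A\<close>, \<open>R\<close> vanishes and \<open>U\<close> already has the sign
      \<open>b\<close>.\<close>
    define R where "R = (\<lambda>y. if y \<in> D then b y * (\<bar>U y\<bar> + 1) else 0)"
    show ?thesis
      unfolding C_def[symmetric]
    proof (rule ptf_of_glued_coeffs[OF f, of U "2 * C" R Z])
      fix y assume y: "y \<in> cube ?n"
      show "U y \<in> \<int> \<and> \<bar>U y\<bar> \<le> 2 * C"
        using U_Ints[OF y] U_le[OF y] C1 by auto
      show "R y \<in> \<int> \<and> \<bar>R y\<bar> \<le> 2 * C"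
        using U_Ints[OF y] U_le[OF y] C1 b_sign[OF y] by (auto simp: R_def Ints_abs)
    next
      fix y and t :: real assume y: "y \<in> cube ?n" and t: "t \<in> {-1, 1}"
      show "f (y(Suc ?n := t)) * (U y + t * R y) > 0"
      proof (cases "y \<in> D")
        case True
        have "t * b y * (1 * U y + (t * b y) * (\<bar>U y\<bar> + 1)) > 0"
          by (rule dominate) (use t b_sign[OF y] in auto)
        then show ?thesis
          using True by (simp add: f_in[OF True t] R_def mult.assoc)
      next
        case False
        then show ?thesis
          using U_pos[of y] y A(1) f_out[of y t] t by (auto simp: R_def)
      qed
    next
      show "Z \<subseteq> Pow {1..Suc ?n}"
        using Z(1) Pow_Suc(1) by blast
      show "2 ^ Suc ?n \<le> 4 * card Z"
        using Z(2) by simp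
      show "glued_coeffs ?n U R S = 0" if "S \<in> Z" for S
      proof -
        have "Suc ?n \<notin> S"
          using Z(1) Pow_Suc(3)[of S] that by blast
        then show ?thesis
          using ZU[OF that] by (simp add: glued_coeffs_def)
      qed
    qed
  next
    case 2
    then obtain A where A: "A \<subseteq> cube ?n - D" "card A = 2 ^ m"
      by (meson obtain_subset_with_card_n)
    have A_cube: "A \<subseteq> cube ?n"
      using A(1) by blast
    obtain Z U where Z: "Z \<subseteq> Pow {1..?n}" "card Z = 2 ^ m"
      and ZU: "\<And>S. S \<in> Z \<Longrightarrow> (\<Sum>y\<in>cube ?n. U y * character S y) = 0"
      and U_Ints: "\<And>y. y \<in> cube ?n \<Longrightarrow> U y \<in> \<int>"
      and U_le: "\<And>y. y \<in> cube ?n \<Longrightarrow> \<bar>U y\<bar> \<le> C"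
      and U_pos: "\<And>y. y \<in> cube ?n - A \<Longrightarrow> b y * U y > 0"
      by (rule cube_integral_annihilator[OF A_cube A(2) b_sign, folded C_def]) (assumption, rule that)
    have C1: "C \<ge> 1"
      using C_ge[OF A_cube A(2), of U] U_Ints U_le U_pos by blast
    \<comment> \<open>The roles are exchanged: \<open>U\<close> multiplies \<open>t\<close> and is
      dominated by \<open>P\<close> outside \<open>D\<close>. On \<open>D\<close> only
      \<open>t * U y\<close> remains, with the sign of \<open>t * b y\<close>. The vanishing
      coefficients now belong to the sets of \<open>Z\<close> enlarged by the last index.\<close>
    define P where "P = (\<lambda>y. if y \<in> D then 0 else b y * (\<bar>U y\<bar> + 1))"
    have notin: "Suc ?n \<notin> S" if "S \<in> Z" for S
      using Z(1) Pow_Suc(3)[of S] that by blast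
    show ?thesis
      unfolding C_def[symmetric]
    proof (rule ptf_of_glued_coeffs[OF f, of P "2 * C" U "insert (Suc ?n) ` Z"])
      fix y assume y: "y \<in> cube ?n"
      show "U y \<in> \<int> \<and> \<bar>U y\<bar> \<le> 2 * C"
        using U_Ints[OF y] U_le[OF y] C1 by auto
      show "P y \<in> \<int> \<and> \<bar>P y\<bar> \<le> 2 * C"
        using U_Ints[OF y] U_le[OF y] C1 b_sign[OF y] by (auto simp: P_def Ints_abs)
    next
      fix y and t :: real assume y: "y \<in> cube ?n" and t: "t \<in> {-1, 1}"
      show "f (y(Suc ?n := t)) * (P y + t * U y) > 0"
      proof (cases "y \<in> D")
        case True
        then have "b y * U y > 0"
          using U_pos[of y] y A(1) by auto
        then show ?thesis
          unfolding f_in[OF True t] using t True by (auto simp: P_def)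
      next
        case False
        have "b y * (t * U y + b y * (\<bar>U y\<bar> + 1)) > 0"
          by (rule dominate) (use t b_sign[OF y] in auto)
        then show ?thesis
          using False y t by (simp add: f_out P_def add.commute)
      qed
    next
      show "insert (Suc ?n) ` Z \<subseteq> Pow {1..Suc ?n}"
        using Z(1) Pow_Suc(2) by blast
      have "inj_on (insert (Suc ?n)) Z"
        by (rule inj_onI) (use notin in \<open>metis insert_ident\<close>)
      then show "2 ^ Suc ?n \<le> 4 * card (insert (Suc ?n) ` Z)"
        using Z(2) by (simp add: card_image)
      show "glued_coeffs ?n P U S = 0" if S: "S \<in> insert (Suc ?n) ` Z" for S
      proof -
        obtain T where T: "T \<in> Z" "S = insert (Suc ?n) T"
          using S by blast
        then have "S - {Suc ?n} = T"
          using notin by blast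
        then show ?thesis
          using T ZU by (simp add: glued_coeffs_def)
      qed
    qed
  qed
qed

theorem theorem3:
  fixes n :: nat and f :: "(nat \<Rightarrow> real) \<Rightarrow> real"
  assumes "n \<ge> 1" and "boolean_function n f"
  shows "\<exists>w :: nat set \<Rightarrow> real.
    ptf_representation n w f \<and>
    real (ptf_length n w) \<le> 0.75 * 2 ^ n \<and>
    (\<forall>S\<in>Pow {1..n}. w S \<in> \<int> \<and>
       \<bar>w S\<bar> \<le> 2 powr (real n * 2 powr (real n - 3) - 2 powr (real n - 1) + 4 * real n)) \<and>
    (let h = 2 ^ n :: real in
       Max ((\<lambda>S. \<bar>w S\<bar>) ` Pow {1..n}) \<le> 2 powr (0.125 * h * log 2 h - 0.5 * h + 4 * log 2 h))"
proof -
  let ?B = "2 powr (real n * 2 powr (real n - 3) - 2 powr (real n - 1) + 4 * real n)"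
  have weaken: "\<exists>w. ptf_representation n w f \<and> real (ptf_length n w) \<le> 0.75 * 2 ^ n \<and>
      (\<forall>S\<in>Pow {1..n}. w S \<in> \<int> \<and> \<bar>w S\<bar> \<le> ?B)"
    if w: "\<exists>w. ptf_representation n w f \<and> real (ptf_length n w) \<le> 0.75 * 2 ^ n \<and>
      (\<forall>S\<in>Pow {1..n}. w S \<in> \<int> \<and> \<bar>w S\<bar> \<le> C)" and C: "C \<le> ?B" for C
    using w order_trans[OF _ C] by blast
  have "\<exists>w. ptf_representation n w f \<and> real (ptf_length n w) \<le> 0.75 * 2 ^ n \<and>
    (\<forall>S\<in>Pow {1..n}. w S \<in> \<int> \<and> \<bar>w S\<bar> \<le> ?B)"
  proof (cases "n = 1")
    case True
    \<comment> \<open>For \<open>n = 1\<close> the exponent is \<open>1/4 - 1 + 4\<close>, which is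
      positive.\<close>
    have "(1 :: real) \<le> 2 powr (real 1 * 2 powr (real 1 - 3) - 2 powr (real 1 - 1) + 4 * real 1)"
      by (intro ge_one_powr_ge_zero) (simp_all add: add_nonneg_nonneg)
    then have "1 \<le> ?B"
      unfolding True .
    then show ?thesis
      by (rule weaken[rotated]) (use ptf_one_variable[of f] assms(2) True in \<open>simp only: One_nat_def\<close>)
  next
    case False
    obtain m where n: "n = Suc (Suc m)"
      by (rule that[of "n - 2"]) (use assms(1) False in simp)
    then have "2 ^ Suc m * (2 * (2 ^ m * ((2 ^ m) powr (2 ^ m / 2) / 2 ^ (2 ^ m - 1)))) \<le> ?B"
      using coefficient_bound[of m] by (simp only: add_2_eq_Suc')
    then show ?thesis
      by (rule weaken[rotated]) (use ptf_at_least_two_variables[of m f] assms(2) n in \<open>simp only:\<close>)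
  qed
  then obtain w where w: "ptf_representation n w f" "real (ptf_length n w) \<le> 0.75 * 2 ^ n"
    "\<And>S. S \<in> Pow {1..n} \<Longrightarrow> w S \<in> \<int> \<and> \<bar>w S\<bar> \<le> ?B"
    by blast
  have max: "Max ((\<lambda>S. \<bar>w S\<bar>) ` Pow {1..n}) \<le> ?B"
    by (rule Max.boundedI) (use w(3) in auto)
  \<comment> \<open>With \<open>h = 2 ^ n\<close>, \<open>log 2 h\<close> is \<open>n\<close>, and
    0.125 and 0.5 are the powers of two that shift the exponent by 3 and by 1.\<close>
  have exponent: "real n * 2 powr (real n - 3) - 2 powr (real n - 1) + 4 * real n
      = 0.125 * 2 ^ n * log 2 (2 ^ n) - 0.5 * 2 ^ n + 4 * log 2 (2 ^ n)"
    by (simp add: powr_diff powr_realpow log_nat_power)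
  show ?thesis
    unfolding Let_def using w max[unfolded exponent] by blast
qed

end
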